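(* Let $I$ be a directed poset, $(\Omega,\mathcal F,(\mathcal F_i)_{i\in I},\mathbb P)$ a filtered probability space, and $r>0$ a real number. Consider a family $(\mu_i)_{i\in I}$ such that $\mu_i$ is a measure on $\mathbf\Omega_i=(\Omega,\mathcal F_i,\mathbb P|_{\mathcal F_i})$ and $\mu_i\le r\mathbb P|_{\mathcal F_i}$. Suppose that for all $i\le j$, $$\mu_j|_{\mathcal F_i}=\mu_i.$$ Then there exists a unique measure $\mu$ on $(\Omega,\mathcal F)$ with $\mu\le r\mathbb P$ such that for all $i\in I$, $$\mu|_{\mathcal F_i}=\mu_i.$$
   Context: A filtered probability space is a probability space $(\Omega,\mathcal F,\mathbb P)$ with sub-$\sigma$-algebras $\mathcal F_i\subseteq\mathcal F$ ($i\in I$) such that $\mathcal F_i\subseteq\mathcal F_j$ for $i\le j$ and $\sigma(\bigcup_{i\in I}\mathcal F_i)=\mathcal F$. For measures, $\mu\le r\mathbb P$ means $\mu(A)\le r\mathbb P(A)$ for all measurable sets $A$ of the $\sigma$-algebra on which $\mu$ is defined. *)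

theory Defs
  imports "HOL-Probability.Probability"
begin

text \<open>A subset of a partially ordered type, with the induced order, is a directed poset
  (directed sets are nonempty).\<close>

definition directed_poset :: "'i::order set \<Rightarrow> bool" where
  "directed_poset I \<longleftrightarrow> I \<noteq> {} \<and> (\<forall>i\<in>I. \<forall>j\<in>I. \<exists>k\<in>I. i \<le> k \<and> j \<le> k)"

text \<open>As in the library's \<^const>\<open>subalgebra\<close>, a sub-sigma-algebra is given by a value \<open>F i\<close> of type
  \<open>measure\<close> of which only the space and the measurable sets matter. The measure
  \<open>\<mu>\<close> restricted to the sigma-algebra of \<open>F i\<close> is \<open>restr_to_subalg \<mu> (F i)\<close>.\<close>

locale filtered_prob_space = prob_space M
  for M :: "'a measure" and I :: "'i::order set" and F :: "'i \<Rightarrow> 'a measure" +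
  assumes subalg: "i \<in> I \<Longrightarrow> subalgebra M (F i)"
    and sets_mono: "i \<in> I \<Longrightarrow> j \<in> I \<Longrightarrow> i \<le> j \<Longrightarrow> sets (F i) \<subseteq> sets (F j)"
    and sets_generated: "sigma_sets (space M) (\<Union>i\<in>I. sets (F i)) = sets M"

text \<open>\<open>\<mu> \<le> r \<nu>\<close> setwise; the order \<open>\<le>\<close> on the type \<open>measure\<close> is not used, since it also
  compares measures with different sigma-algebras.\<close>

definition dominated_by :: "'a measure \<Rightarrow> real \<Rightarrow> 'a measure \<Rightarrow> bool" where
  "dominated_by \<mu> r \<nu> \<longleftrightarrow> (\<forall>A\<in>sets \<mu>. emeasure \<mu> A \<le> ennreal r * emeasure \<nu> A)"

end

theory Submission
  imports Defs
begin

text \<open>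
  Since the index set is directed, the union of the \<open>\<F>\<^sub>i\<close> is an algebra of sets, and compatibility
  glues the \<open>\<mu>\<^sub>i\<close> into a single finitely additive set function on it. In general a projective family of
  measures need not come from a countably additive one. Here the bound by \<open>r \<P>\<close> settles the matter:
  if \<open>A\<^sub>n\<close> decreases to the empty set, then \<open>\<mu>(A\<^sub>n) \<le> r \<P>(A\<^sub>n) \<longrightarrow> 0\<close>, so the set function is continuous
  at the empty set and Caratheodory's theorem extends it to the generated sigma-algebra.

  That the extension is still bounded by \<open>r \<P>\<close> follows from the same extension result applied to the
  defect \<open>r \<P> - \<mu>\<close>, which is also additive and bounded by \<open>r \<P>\<close> on the algebra. The sum of the two
  extensions agrees with \<open>r \<P>\<close> on the algebra, hence everywhere, because a finite measure is determined by
  its values on a generating algebra; the latter fact also gives uniqueness.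
\<close>

lemma finite_measure_eqI_algebra:
  assumes "algebra \<Omega> E" "sets M = sigma_sets \<Omega> E" "sets N = sigma_sets \<Omega> E"
    and "emeasure N \<Omega> \<noteq> \<infinity>"
    and "\<And>X. X \<in> E \<Longrightarrow> emeasure M X = emeasure N X"
  shows "M = N"
proof -
  interpret algebra \<Omega> E by fact
  show ?thesis
    by (rule measure_eqI_generator_eq[where \<Omega> = \<Omega> and E = E and A = "\<lambda>_. \<Omega>"])
       (use assms space_closed top in \<open>auto simp: Int_stable_def\<close>)
qed

text \<open>Domination by a finite measure supplies what Caratheodory's theorem asks of a finitely additive
  set function: along sets decreasing to the empty set the values are squeezed to \<^term>\<open>0\<close>.\<close>

lemma (in algebra) dominated_additive_extends:
  assumes N: "finite_measure N" "sets N = sigma_sets \<Omega> M"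
    and f: "f {} = 0" "additive M f"
    and le: "\<And>A. A \<in> M \<Longrightarrow> f A \<le> emeasure N A"
  obtains \<nu> where "sets \<nu> = sets N" "\<And>A. A \<in> M \<Longrightarrow> emeasure \<nu> A = f A"
proof -
  interpret N: finite_measure N by fact
  have sub: "M \<subseteq> sets N" using N(2) by auto
  have "\<exists>m. (\<forall>s\<in>M. m s = f s) \<and> measure_space \<Omega> (sigma_sets \<Omega> M) m"
  proof (rule caratheodory_empty_continuous)
    show "positive M f" using f(1) by (simp add: positive_def)
    show "f A \<noteq> \<infinity>" if "A \<in> M" for A
      using le[OF that] N.emeasure_finite[of A] by (auto simp: top_unique)
    fix A :: "nat \<Rightarrow> 'a set" assume A: "range A \<subseteq> M" "decseq A" "(\<Inter>i. A i) = {}"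
    have "(\<lambda>i. emeasure N (A i)) \<longlonglongrightarrow> emeasure N (\<Inter>i. A i)"
      using A sub by (intro Lim_emeasure_decseq) auto
    then have "(\<lambda>i. emeasure N (A i)) \<longlonglongrightarrow> 0" using A by simp
    then show "(\<lambda>i. f (A i)) \<longlonglongrightarrow> 0"
      by (rule tendsto_sandwich[OF _ _ tendsto_const, rotated -1])
         (use le A in \<open>auto intro!: always_eventually\<close>)
  qed (fact f)
  then obtain m where m: "\<forall>s\<in>M. m s = f s" "measure_space \<Omega> (sigma_sets \<Omega> M) m"
    by blast
  have "emeasure (measure_of \<Omega> M m) A = f A" if "A \<in> M" for A
    using m that space_closed
    by (subst emeasure_measure_of[OF refl]) (auto simp: measure_space_def)
  then show thesis
    using that[of "measure_of \<Omega> M m"] space_closed N(2) by simp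
qed

lemma add_measures:
  fixes \<nu> \<nu>' :: "'a measure"
  assumes "sets \<nu>' = sets \<nu>"
  obtains \<sigma> where "sets \<sigma> = sets \<nu>"
    "\<And>A. A \<in> sets \<nu> \<Longrightarrow> emeasure \<sigma> A = emeasure \<nu> A + emeasure \<nu>' A"
proof
  let ?\<sigma> = "measure_of (space \<nu>) (sets \<nu>) (\<lambda>A. emeasure \<nu> A + emeasure \<nu>' A)"
  show "sets ?\<sigma> = sets \<nu>" by simp
  show "emeasure ?\<sigma> A = emeasure \<nu> A + emeasure \<nu>' A" if "A \<in> sets \<nu>" for A
  proof (rule emeasure_measure_of_sigma)
    show "countably_additive (sets \<nu>) (\<lambda>A. emeasure \<nu> A + emeasure \<nu>' A)"
      by (auto simp: countably_additive_def suminf_emeasure assms simp flip: suminf_add)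
  qed (use that in \<open>auto simp: positive_def sets.sigma_algebra_axioms\<close>)
qed

text \<open>The bound passes from the algebra to the sigma-algebra by extending the defect
  \<^term>\<open>\<lambda>A. emeasure N A - f A\<close> as well: the two extensions add up to \<^term>\<open>N\<close>.\<close>

lemma (in algebra) dominated_additive_extends_dominated:
  assumes N: "finite_measure N" "sets N = sigma_sets \<Omega> M"
    and f: "f {} = 0" "additive M f"
    and le: "\<And>A. A \<in> M \<Longrightarrow> f A \<le> emeasure N A"
  obtains \<nu> where "sets \<nu> = sets N" "\<And>A. A \<in> M \<Longrightarrow> emeasure \<nu> A = f A"
    "\<And>A. A \<in> sets N \<Longrightarrow> emeasure \<nu> A \<le> emeasure N A"
proof -
  interpret N: finite_measure N by fact
  define g where "g A = emeasure N A - f A" for A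
  have fin: "f A \<noteq> \<infinity>" if "A \<in> M" for A
    using le[OF that] N.emeasure_finite[of A] by (auto simp: top_unique)
  have "additive M g"
    unfolding additive_def
  proof (intro ballI impI)
    fix A B assume AB: "A \<in> M" "B \<in> M" "A \<inter> B = {}"
    have "emeasure N (A \<union> B) = emeasure N A + emeasure N B"
      using AB N(2) by (intro plus_emeasure[symmetric]) auto
    moreover have "f (A \<union> B) = f A + f B"
      using AB f(2) by (auto simp: additive_def)
    ultimately have "g (A \<union> B) = emeasure N A + emeasure N B - f B - f A"
      by (simp add: g_def diff_add_eq_diff_diff_swap_ennreal diff_diff_commute_ennreal)
    also have "\<dots> = g A + g B"
      using le[OF AB(1)] le[OF AB(2)]
      by (simp add: g_def add_diff_eq_ennreal diff_add_assoc2_ennreal diff_diff_commute_ennreal)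
    finally show "g (A \<union> B) = g A + g B" .
  qed
  moreover have "g {} = 0" by (simp add: g_def f)
  ultimately obtain \<nu>' where \<nu>': "sets \<nu>' = sets N" "\<And>A. A \<in> M \<Longrightarrow> emeasure \<nu>' A = g A"
    using dominated_additive_extends[OF N, of g] by (auto simp: g_def)
  obtain \<nu> where \<nu>: "sets \<nu> = sets N" "\<And>A. A \<in> M \<Longrightarrow> emeasure \<nu> A = f A"
    using dominated_additive_extends[OF N f le] by blast
  obtain \<sigma> where \<sigma>: "sets \<sigma> = sets \<nu>"
      "\<And>A. A \<in> sets \<nu> \<Longrightarrow> emeasure \<sigma> A = emeasure \<nu> A + emeasure \<nu>' A"
    using add_measures[of \<nu>' \<nu>] \<nu>(1) \<nu>'(1) by metis
  have "\<sigma> = N"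
  proof (rule finite_measure_eqI_algebra[OF algebra_axioms])
    fix X assume X: "X \<in> M"
    then have "X \<in> sets N" using N(2) by auto
    then show "emeasure \<sigma> X = emeasure N X"
      using X \<sigma>(2) \<nu> \<nu>' le by (simp add: g_def)
  qed (use \<sigma> \<nu> N in auto)
  then have "emeasure \<nu> A \<le> emeasure N A" if "A \<in> sets N" for A
    using \<sigma>(2)[of A] \<nu>(1) that by simp
  then show thesis using that \<nu> by blast
qed

context filtered_prob_space
begin

lemma space_subalg: "i \<in> I \<Longrightarrow> space (F i) = space M"
  using subalg by (auto simp: subalgebra_def)

text \<open>Directedness puts any two members of the union into one common sigma-algebra, where Boolean
  operations can be performed.\<close>

lemma common_subalg:
  assumes "directed_poset I" "A \<in> (\<Union>i\<in>I. sets (F i))" "B \<in> (\<Union>i\<in>I. sets (F i))"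
  obtains k where "k \<in> I" "A \<in> sets (F k)" "B \<in> sets (F k)"
proof -
  from assms obtain i j where ij: "i \<in> I" "j \<in> I" "A \<in> sets (F i)" "B \<in> sets (F j)" by auto
  with assms(1) obtain k where "k \<in> I" "i \<le> k" "j \<le> k" unfolding directed_poset_def by blast
  with ij that sets_mono show thesis by blast
qed

lemma algebra_Union_subalg:
  assumes dir: "directed_poset I"
  shows "algebra (space M) (\<Union>i\<in>I. sets (F i))"
  unfolding algebra_iff_Un
proof (intro conjI ballI)
  show "(\<Union>i\<in>I. sets (F i)) \<subseteq> Pow (space M)"
    using sets.sets_into_space space_subalg by fastforce
  show "{} \<in> (\<Union>i\<in>I. sets (F i))" using dir by (auto simp: directed_poset_def)
next
  fix A assume "A \<in> (\<Union>i\<in>I. sets (F i))"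
  then obtain i where "i \<in> I" "A \<in> sets (F i)" by blast
  then show "space M - A \<in> (\<Union>i\<in>I. sets (F i))"
    using sets.compl_sets[of A "F i"] space_subalg by auto
next
  fix A B assume "A \<in> (\<Union>i\<in>I. sets (F i))" "B \<in> (\<Union>i\<in>I. sets (F i))"
  then show "A \<union> B \<in> (\<Union>i\<in>I. sets (F i))"
    using common_subalg[OF dir, of A B] by (metis UN_I sets.Un)
qed

text \<open>Two members of the family agree on a set measurable for both, since both agree there with the
  member at a common upper bound. So the value at a set may be read off at any index, and
  additivity is inherited from a single measure that sees both sets.\<close>

lemma compatible_family_glues:
  fixes \<mu> :: "'i \<Rightarrow> 'a measure"
  assumes dir: "directed_poset I"
    and sets_\<mu>: "\<And>i. i \<in> I \<Longrightarrow> sets (\<mu> i) = sets (F i)"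
    and compat: "\<And>i j. i \<in> I \<Longrightarrow> j \<in> I \<Longrightarrow> i \<le> j \<Longrightarrow> restr_to_subalg (\<mu> j) (F i) = \<mu> i"
  obtains f where "f {} = 0" "additive (\<Union>i\<in>I. sets (F i)) f"
    "\<And>i A. i \<in> I \<Longrightarrow> A \<in> sets (F i) \<Longrightarrow> f A = emeasure (\<mu> i) A"
proof -
  have up: "emeasure (\<mu> j) A = emeasure (\<mu> i) A"
    if "i \<in> I" "j \<in> I" "i \<le> j" "A \<in> sets (F i)" for i j A
  proof -
    have "subalgebra (\<mu> j) (F i)"
      using that sets_mono sets_\<mu>[THEN sets_eq_imp_space_eq] sets_\<mu> space_subalg
      by (auto simp: subalgebra_def)
    then show ?thesis
      using emeasure_restr_to_subalg[of "\<mu> j" "F i" A] compat[of i j] that by simp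
  qed
  have indep: "emeasure (\<mu> i) A = emeasure (\<mu> j) A"
    if "i \<in> I" "j \<in> I" "A \<in> sets (F i)" "A \<in> sets (F j)" for i j A
  proof -
    from that dir obtain k where "k \<in> I" "i \<le> k" "j \<le> k" unfolding directed_poset_def by blast
    then show ?thesis using up[of i k A] up[of j k A] that by simp
  qed
  define f where "f A = emeasure (\<mu> (SOME i. i \<in> I \<and> A \<in> sets (F i))) A" for A
  have f: "f A = emeasure (\<mu> i) A" if "i \<in> I" "A \<in> sets (F i)" for i A
    using someI[of "\<lambda>i. i \<in> I \<and> A \<in> sets (F i)" i] that indep unfolding f_def by blast
  have "additive (\<Union>i\<in>I. sets (F i)) f"
    unfolding additive_def
  proof (intro ballI impI)
    fix A B assume AB: "A \<in> (\<Union>i\<in>I. sets (F i))" "B \<in> (\<Union>i\<in>I. sets (F i))" "A \<inter> B = {}"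
    obtain k where "k \<in> I" "A \<in> sets (F k)" "B \<in> sets (F k)"
      using common_subalg[OF dir AB(1,2)] .
    then show "f (A \<union> B) = f A + f B"
      using plus_emeasure[of A "\<mu> k" B] AB(3) by (simp add: f sets_\<mu>)
  qed
  moreover have "f {} = 0" by (simp add: f_def)
  ultimately show thesis using that f by blast
qed

end

theorem theorem3p18:
  fixes M :: "'a measure" and I :: "'i::order set" and F \<mu> :: "'i \<Rightarrow> 'a measure" and r :: real
  assumes "directed_poset I"
    and "filtered_prob_space M I F"
    and "r > 0"
    and "\<And>i. i \<in> I \<Longrightarrow> sets (\<mu> i) = sets (F i)"
    and "\<And>i. i \<in> I \<Longrightarrow> dominated_by (\<mu> i) r (restr_to_subalg M (F i))"
    and "\<And>i j. i \<in> I \<Longrightarrow> j \<in> I \<Longrightarrow> i \<le> j \<Longrightarrow> restr_to_subalg (\<mu> j) (F i) = \<mu> i"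
  shows "\<exists>!\<nu>::'a measure. sets \<nu> = sets M \<and> dominated_by \<nu> r M \<and>
           (\<forall>i\<in>I. restr_to_subalg \<nu> (F i) = \<mu> i)"
proof -
  interpret filtered_prob_space M I F by fact
  let ?A = "\<Union>i\<in>I. sets (F i)"
  interpret A: algebra "space M" ?A by (rule algebra_Union_subalg) fact
  let ?N = "scale_measure (ennreal r) M"
  have subalg': "subalgebra \<nu> (F i)" if "sets \<nu> = sets M" "i \<in> I" for \<nu> i
    using subalg[OF that(2)] that(1) sets_eq_imp_space_eq[OF that(1)] by (simp add: subalgebra_def)
  obtain f where f: "f {} = 0" "additive ?A f"
    "\<And>i A. i \<in> I \<Longrightarrow> A \<in> sets (F i) \<Longrightarrow> f A = emeasure (\<mu> i) A"
    using compatible_family_glues[OF assms(1,4,6)] by blast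
  have "finite_measure ?N"
    by (intro finite_measureI) (simp add: space_scale_measure emeasure_space_1)
  moreover have "sets ?N = sigma_sets (space M) ?A" by (simp add: sets_generated)
  moreover have "f A \<le> emeasure ?N A" if "A \<in> ?A" for A
  proof -
    from that obtain i where i: "i \<in> I" "A \<in> sets (F i)" by blast
    then show ?thesis
      using assms(5)[OF i(1)] emeasure_restr_to_subalg[OF subalg[OF i(1)] i(2)]
      by (auto simp: f(3) dominated_by_def assms(4))
  qed
  ultimately obtain \<nu> where \<nu>: "sets \<nu> = sets ?N" "\<And>A. A \<in> ?A \<Longrightarrow> emeasure \<nu> A = f A"
    "\<And>A. A \<in> sets ?N \<Longrightarrow> emeasure \<nu> A \<le> emeasure ?N A"
    using A.dominated_additive_extends_dominated[of ?N f] f(1,2) by blast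
  have sets_\<nu>: "sets \<nu> = sets M" using \<nu>(1) by simp
  have dom_\<nu>: "dominated_by \<nu> r M" using \<nu>(3) by (auto simp: dominated_by_def sets_\<nu>)
  have restr_\<nu>: "restr_to_subalg \<nu> (F i) = \<mu> i" if "i \<in> I" for i
  proof (rule measure_eqI)
    note sub = subalg'[OF sets_\<nu> that]
    show "sets (restr_to_subalg \<nu> (F i)) = sets (\<mu> i)"
      using sets_restr_to_subalg[OF sub] assms(4)[OF that] by simp
    fix A assume "A \<in> sets (restr_to_subalg \<nu> (F i))"
    then have A: "A \<in> sets (F i)" using sets_restr_to_subalg[OF sub] by simp
    then show "emeasure (restr_to_subalg \<nu> (F i)) A = emeasure (\<mu> i) A"
      using emeasure_restr_to_subalg[OF sub A] \<nu>(2)[of A] f(3)[OF that A] that by auto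
  qed
  show ?thesis
  proof (intro ex1I[of _ \<nu>] conjI ballI)
    fix \<rho> :: "'a measure"
    assume \<rho>: "sets \<rho> = sets M \<and> dominated_by \<rho> r M \<and> (\<forall>i\<in>I. restr_to_subalg \<rho> (F i) = \<mu> i)"
    show "\<rho> = \<nu>"
    proof (rule finite_measure_eqI_algebra[OF A.algebra_axioms])
      have "emeasure \<nu> (space M) \<le> ennreal r * emeasure M (space M)"
        using \<nu>(3)[of "space M"] by simp
      then show "emeasure \<nu> (space M) \<noteq> \<infinity>" by (auto simp: emeasure_space_1 top_unique)
    next
      fix X assume "X \<in> ?A"
      then obtain i where i: "i \<in> I" "X \<in> sets (F i)" by blast
      have "emeasure \<rho> X = emeasure (\<mu> i) X"
        using emeasure_restr_to_subalg[OF subalg'[of \<rho>, OF _ i(1)] i(2)] \<rho> i(1) by simp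
      also have "\<dots> = emeasure \<nu> X"
        using emeasure_restr_to_subalg[OF subalg'[OF sets_\<nu> i(1)] i(2)] restr_\<nu>[OF i(1)] by simp
      finally show "emeasure \<rho> X = emeasure \<nu> X" .
    qed (use \<rho> sets_\<nu> sets_generated in auto)
  qed (use sets_\<nu> dom_\<nu> restr_\<nu> in auto)
qed

end
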